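(* Let $H$ be an $n$-vertex $r$-uniform hypergraph which is codegree regular. Then for all weight vectors $x$ and $t\ge 1$, \[\mathbb{E}\left[\|R^t(x)-\overline{x}\|_2^2\right]=\left(1-\frac{r-1}{n-1}\right)^t\|x-\overline{x}\|_2^2.\] Moreover, the limit \[\lim_{t\to\infty}\ \|R^t(x)-\overline{x}\|_2^2\Big/\left(1-\frac{r-1}{n-1}\right)^t\] exists and is finite almost surely.
   Context: A hypergraph $H$ is a set of vertices $V(H)$ together with a multiset $E(H)$ of subsets of $V(H)$, called edges (edges may be repeated). $H$ is $r$-uniform if $|e|=r$ for all $e\in E(H)$. For $u\neq v$ the codegree $d(u,v)$ is the number of edges (with multiplicity) containing both $u$ and $v$; $H$ is codegree regular if there is some $d$ with $d(u,v)=d$ for all $u\neq v$. A weight vector of $H$ is a real-valued vector $x=(x_v)_{v\in V(H)}$. The random vector $R(x)$ is obtained by choosing an edge $e$ uniformly at random from $E(H)$ and setting $R(x)_u=x_u$ if $u\notin e$ and $R(x)_u=|e|^{-1}\sum_{v\in e}x_v$ if $u\in e$. The process is defined recursively by $R^1(x)=R(x)$ and $R^t(x)=R(R^{t-1}(x))$; equivalently, $R^t(x)$ is obtained by uniformly generating a sequence of edges $e_1,e_2,\dots$ and performing the averaging for $e_1,\dots,e_t$ sequentially. With $n=|V(H)|$, $\overline{x}$ is the vector all of whose coordinates equal $\frac1n\sum_u x_u$. *)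

theory Defs
  imports "HOL-Probability.Probability"
begin

locale hypergraph =
  fixes V :: "'a set" and E :: "'a set multiset"
  assumes finite_vertices: "finite V"
    and edges_subset: "\<And>e. e \<in># E \<Longrightarrow> e \<subseteq> V"

definition uniform_hypergraph :: "nat \<Rightarrow> 'a set multiset \<Rightarrow> bool" where
  "uniform_hypergraph r E \<longleftrightarrow> (\<forall>e\<in>#E. card e = r)"

definition codegree :: "'a set multiset \<Rightarrow> 'a \<Rightarrow> 'a \<Rightarrow> nat" where
  "codegree E u v = size {#e \<in># E. u \<in> e \<and> v \<in> e#}"

definition codegree_regular :: "'a set \<Rightarrow> 'a set multiset \<Rightarrow> bool" where
  "codegree_regular V E \<longleftrightarrow> (\<exists>d. \<forall>u\<in>V. \<forall>v\<in>V. u \<noteq> v \<longrightarrow> codegree E u v = d)"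

(* Weight vectors indexed by V are represented by total functions, of which only
   the values on V are relevant. *)

definition average_edge :: "'a set \<Rightarrow> ('a \<Rightarrow> real) \<Rightarrow> ('a \<Rightarrow> real)" where
  "average_edge e x = (\<lambda>u. if u \<in> e then (\<Sum>v\<in>e. x v) / real (card e) else x u)"

definition mean_vector :: "'a set \<Rightarrow> ('a \<Rightarrow> real) \<Rightarrow> ('a \<Rightarrow> real)" where
  "mean_vector V x = (\<lambda>_. (\<Sum>u\<in>V. x u) / real (card V))"

(* e 0, e 1, ... are independent edges of E on the probability space M, each chosen
   uniformly with multiplicity. Using count_space (set_mset E) makes them take values in E
   everywhere and not only almost surely; on an uncountable vertex type, the averaging
   process could otherwise fail to be measurable on a null set. *)
definition uniform_edge_sequence ::
  "'w measure \<Rightarrow> 'a set multiset \<Rightarrow> (nat \<Rightarrow> 'w \<Rightarrow> 'a set) \<Rightarrow> bool" where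
  "uniform_edge_sequence M E e \<longleftrightarrow>
     prob_space M \<and>
     prob_space.indep_vars M (\<lambda>_. count_space (set_mset E)) e UNIV \<and>
     (\<forall>t. distr M (count_space UNIV) (e t) = measure_pmf (pmf_of_multiset E))"

(* The random vector R^t(x) as a function of the outcome. Edges are indexed from 0,
   so e t is the edge used in step t + 1. *)
primrec averaging_process ::
  "(nat \<Rightarrow> 'w \<Rightarrow> 'a set) \<Rightarrow> ('a \<Rightarrow> real) \<Rightarrow> nat \<Rightarrow> 'w \<Rightarrow> ('a \<Rightarrow> real)" where
  "averaging_process e x 0 \<omega> = x"
| "averaging_process e x (Suc t) \<omega> = average_edge (e t \<omega>) (averaging_process e x t \<omega>)"

end

theory Submission
  imports Defs
begin

text \<open>
  Averaging over an edge \<open>f\<close> lowers the dispersion \<open>\<parallel>x - mean\<parallel>\<^sup>2\<close> by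
  \<open>1 / (2r)\<close> times the sum of \<open>(x u - x v)\<^sup>2\<close> over \<open>u, v \<in> f\<close>. Summed over all edges, each pair of
  distinct vertices is counted codegree many times, so codegree regularity makes the total a fixed
  multiple of the dispersion itself, and the multiple is found by counting pairs. Hence one step
  multiplies the expected dispersion by \<open>c = 1 - (r - 1) / (n - 1)\<close>, whatever the current state, and
  the dispersion divided by \<open>c ^ t\<close> is a nonnegative martingale. It converges almost surely: by
  Doob's upcrossing inequality it crosses no rational interval infinitely often, and by Fatou's lemma
  its limit inferior is finite.
\<close>

subsection \<open>Dispersion and edge averaging\<close>

text \<open>The centre is the mean of the argument itself, so this is a function of the current
  state alone.\<close>

definition dispersion :: "'a set \<Rightarrow> ('a \<Rightarrow> real) \<Rightarrow> real" where
  "dispersion V x = (L2_set (\<lambda>v. x v - mean_vector V x v) V)\<^sup>2"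

lemma dispersion_nonneg: "0 \<le> dispersion V x"
  by (simp add: dispersion_def)

lemma dispersion_eq:
  "dispersion V x = (\<Sum>v\<in>V. (x v)\<^sup>2) - (\<Sum>v\<in>V. x v)\<^sup>2 / real (card V)"
proof -
  define m where "m = (\<Sum>v\<in>V. x v) / real (card V)"
  have "dispersion V x = (\<Sum>v\<in>V. (x v - m)\<^sup>2)"
    unfolding dispersion_def L2_set_def mean_vector_def m_def
    by (simp add: sum_nonneg)
  also have "\<dots> = (\<Sum>v\<in>V. (x v)\<^sup>2) - 2 * m * (\<Sum>v\<in>V. x v) + real (card V) * m\<^sup>2"
    by (simp add: power2_diff sum.distrib sum_subtractf flip: sum_distrib_left sum_distrib_right)
  also have "\<dots> = (\<Sum>v\<in>V. (x v)\<^sup>2) - (\<Sum>v\<in>V. x v)\<^sup>2 / real (card V)"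
    by (cases "card V = 0") (simp_all add: m_def power2_eq_square field_simps)
  finally show ?thesis .
qed

lemma sum_pairs_diff_squared:
  fixes x :: "'a \<Rightarrow> real"
  shows "(\<Sum>u\<in>S. \<Sum>v\<in>S. (x u - x v)\<^sup>2) =
    2 * real (card S) * (\<Sum>v\<in>S. (x v)\<^sup>2) - 2 * (\<Sum>v\<in>S. x v)\<^sup>2"
proof -
  have "(\<Sum>u\<in>S. \<Sum>v\<in>S. (x u - x v)\<^sup>2) =
      (\<Sum>u\<in>S. real (card S) * (x u)\<^sup>2 + (\<Sum>v\<in>S. (x v)\<^sup>2) - 2 * x u * (\<Sum>v\<in>S. x v))"
    by (simp add: power2_diff sum.distrib sum_subtractf flip: sum_distrib_left sum_distrib_right)
  also have "\<dots> = 2 * real (card S) * (\<Sum>v\<in>S. (x v)\<^sup>2) - 2 * (\<Sum>v\<in>S. x v)\<^sup>2"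
    by (simp add: sum.distrib sum_subtractf power2_eq_square
        flip: sum_distrib_left sum_distrib_right)
  finally show ?thesis .
qed

text \<open>The form in which codegrees can enter: a sum over pairs, with no mean in it.\<close>

lemma dispersion_eq_sum_pairs:
  assumes "finite V"
  shows "2 * real (card V) * dispersion V x = (\<Sum>u\<in>V. \<Sum>v\<in>V. (x u - x v)\<^sup>2)"
  using assms by (cases "V = {}") (simp_all add: dispersion_eq sum_pairs_diff_squared field_simps)

lemma sum_average_edge:
  assumes "finite V" "f \<subseteq> V"
  shows "(\<Sum>v\<in>V. average_edge f x v) = (\<Sum>v\<in>V. x v)"
proof -
  have "finite f" using assms finite_subset by blast
  have "(\<Sum>v\<in>V. average_edge f x v) =
      (\<Sum>v\<in>V - f. average_edge f x v) + (\<Sum>v\<in>f. average_edge f x v)"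
    using assms by (simp add: sum.subset_diff)
  also have "\<dots> = (\<Sum>v\<in>V - f. x v) + (\<Sum>v\<in>f. x v)"
    using \<open>finite f\<close> by (cases "f = {}") (simp_all add: average_edge_def)
  also have "\<dots> = (\<Sum>v\<in>V. x v)"
    using assms by (simp add: sum.subset_diff)
  finally show ?thesis .
qed

text \<open>The mean is preserved and only the squares on \<open>f\<close> change: their sum becomes
  \<open>(\<Sum>v\<in>f. x v)\<^sup>2 / card f\<close>. The loss is \<open>card f\<close> times the
  variance of \<open>x\<close> on \<open>f\<close>, written as a pair sum.\<close>

lemma dispersion_average_edge:
  assumes "finite V" "f \<subseteq> V"
  shows "dispersion V (average_edge f x) =
    dispersion V x - (\<Sum>u\<in>f. \<Sum>v\<in>f. (x u - x v)\<^sup>2) / (2 * real (card f))"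
proof -
  have "finite f" using assms finite_subset by blast
  have "(\<Sum>v\<in>V. (average_edge f x v)\<^sup>2) =
      (\<Sum>v\<in>V - f. (average_edge f x v)\<^sup>2) + (\<Sum>v\<in>f. (average_edge f x v)\<^sup>2)"
    using assms by (simp add: sum.subset_diff)
  also have "\<dots> = (\<Sum>v\<in>V - f. (x v)\<^sup>2) + (\<Sum>v\<in>f. x v)\<^sup>2 / real (card f)"
    using \<open>finite f\<close> by (cases "f = {}") (simp_all add: average_edge_def power2_eq_square)
  also have "\<dots> = (\<Sum>v\<in>V. (x v)\<^sup>2)
      - (\<Sum>u\<in>f. \<Sum>v\<in>f. (x u - x v)\<^sup>2) / (2 * real (card f))"
    using assms \<open>finite f\<close> sum.subset_diff[OF assms(2,1), of "\<lambda>v. (x v)\<^sup>2"]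
    by (cases "f = {}") (simp_all add: sum_pairs_diff_squared field_simps)
  finally show ?thesis
    by (simp add: dispersion_eq sum_average_edge[OF assms])
qed

lemma mean_vector_averaging_process:
  assumes "finite V" "\<And>s. e s \<omega> \<subseteq> V"
  shows "mean_vector V (averaging_process e x t \<omega>) = mean_vector V x"
  using assms by (induction t) (simp_all add: mean_vector_def sum_average_edge)

text \<open>Double counting: \<open>g u v\<close> is counted once for each edge containing both
  \<open>u\<close> and \<open>v\<close>. On the diagonal, \<open>codegree E u u\<close> is the
  degree of \<open>u\<close>.\<close>

lemma sum_pairs_codegree:
  fixes g :: "'a \<Rightarrow> 'a \<Rightarrow> real"
  assumes "finite V" "\<And>f. f \<in># E \<Longrightarrow> f \<subseteq> V"
  shows "(\<Sum>f\<in>#E. \<Sum>u\<in>f. \<Sum>v\<in>f. g u v) =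
    (\<Sum>u\<in>V. \<Sum>v\<in>V. real (codegree E u v) * g u v)"
  using assms(2)
proof (induction E)
  case empty
  then show ?case by (simp add: codegree_def)
next
  case (add f E)
  have f: "f \<subseteq> V" using add.prems by simp
  have "(\<Sum>u\<in>f. \<Sum>v\<in>f. g u v) = (\<Sum>u\<in>V. if u \<in> f then \<Sum>v\<in>f. g u v else 0)"
    using assms(1) f by (simp add: sum.inter_restrict[symmetric] Int_absorb1)
  also have "\<dots> = (\<Sum>u\<in>V. \<Sum>v\<in>V. if u \<in> f \<and> v \<in> f then g u v else 0)"
    using assms(1) f
    by (intro sum.cong refl) (simp add: sum.inter_restrict[symmetric] Int_absorb1)
  finally have *: "(\<Sum>u\<in>f. \<Sum>v\<in>f. g u v) =
      (\<Sum>u\<in>V. \<Sum>v\<in>V. if u \<in> f \<and> v \<in> f then g u v else 0)" .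
  have "real (codegree (add_mset f E) u v) * g u v =
      (if u \<in> f \<and> v \<in> f then g u v else 0) + real (codegree E u v) * g u v" for u v
    by (simp add: codegree_def algebra_simps)
  then show ?case
    using add by (simp add: * sum.distrib)
qed

text \<open>The loss summed over all edges is a pair sum with constant weight \<open>d\<close>,
  hence \<open>d * n / r\<close> times the dispersion. Counting pairs of distinct vertices inside
  edges gives \<open>size E * r * (r - 1) = d * n * (n - 1)\<close>, which eliminates
  \<open>d\<close>.\<close>

lemma sum_dispersion_average_edge:
  assumes H: "hypergraph V E" and E: "E \<noteq> {#}" and r: "r \<ge> 1"
    and unif: "uniform_hypergraph r E" and reg: "codegree_regular V E"
  shows "(\<Sum>f\<in>#E. dispersion V (average_edge f x)) =
    real (size E) * (1 - (real r - 1) / (real (card V) - 1)) * dispersion V x"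
proof -
  interpret hypergraph V E by fact
  define n where "n = card V"
  from reg obtain d where d: "\<And>u v. u \<in> V \<Longrightarrow> v \<in> V \<Longrightarrow> u \<noteq> v \<Longrightarrow> codegree E u v = d"
    by (auto simp: codegree_regular_def)
  have card: "card f = r" if "f \<in># E" for f
    using unif that by (simp add: uniform_hypergraph_def)
  \<comment> \<open>Regularity says nothing about the diagonal, so \<open>g\<close> has to vanish
    there.\<close>
  have codeg: "(\<Sum>f\<in>#E. \<Sum>u\<in>f. \<Sum>v\<in>f. g u v) = real d * (\<Sum>u\<in>V. \<Sum>v\<in>V. g u v)"
    if "\<And>u. g u u = 0" for g :: "'a \<Rightarrow> 'a \<Rightarrow> real"
  proof -
    have "real (codegree E u v) * g u v = real d * g u v" if "u \<in> V" "v \<in> V" for u v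
      using d[OF that] \<open>\<And>u. g u u = 0\<close> by (cases "u = v") auto
    then have "(\<Sum>u\<in>V. \<Sum>v\<in>V. real (codegree E u v) * g u v) = (\<Sum>u\<in>V. \<Sum>v\<in>V. real d * g u v)"
      by (intro sum.cong refl)
    then show ?thesis
      by (simp add: sum_pairs_codegree[OF finite_vertices edges_subset] sum_distrib_left)
  qed
  have off_diagonal: "(\<Sum>u\<in>S. \<Sum>v\<in>S. if u = v then 0 else 1) = real (card S) * (real (card S) - 1)"
    if "finite S" for S :: "'a set"
  proof -
    have "(\<Sum>v\<in>S. if u = v then 0 else 1) = real (card S) - 1" if "u \<in> S" for u
    proof -
      have "(\<Sum>v\<in>S. if u = v then 0 else 1) = (\<Sum>v\<in>S. 1 - (if u = v then 1 else 0 :: real))"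
        by (intro sum.cong) auto
      then show ?thesis using that \<open>finite S\<close> by (simp add: sum_subtractf)
    qed
    then show ?thesis by simp
  qed
  have fin: "finite f" if "f \<in># E" for f
    using edges_subset[OF that] finite_vertices finite_subset by blast
  have "(\<Sum>f\<in>#E. \<Sum>u\<in>f. \<Sum>v\<in>f. if u = v then 0 else 1) = (\<Sum>f\<in>#E. real r * (real r - 1))"
    using off_diagonal[OF fin] card by (intro arg_cong[of _ _ sum_mset] image_mset_cong) simp
  then have count: "real (size E) * (real r * (real r - 1)) = real d * (real n * (real n - 1))"
    using codeg[of "\<lambda>u v. if u = v then 0 else 1"] off_diagonal[OF finite_vertices]
    by (simp add: n_def)
  have "(\<Sum>f\<in>#E. dispersion V (average_edge f x)) =
      (\<Sum>f\<in>#E. dispersion V x - (\<Sum>u\<in>f. \<Sum>v\<in>f. (x u - x v)\<^sup>2) * (1 / (2 * real r)))"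
    using dispersion_average_edge[OF finite_vertices edges_subset] card
    by (intro arg_cong[of _ _ sum_mset] image_mset_cong) simp
  also have "\<dots> = real (size E) * dispersion V x
      - (\<Sum>f\<in>#E. \<Sum>u\<in>f. \<Sum>v\<in>f. (x u - x v)\<^sup>2) * (1 / (2 * real r))"
    by (induction E) (simp_all add: algebra_simps)
  also have "\<dots> = real (size E) * dispersion V x - real d * real n / real r * dispersion V x"
    using r by (simp add: codeg n_def dispersion_eq_sum_pairs[OF finite_vertices, symmetric])
  also have "\<dots> = real (size E) * (1 - (real r - 1) / (real n - 1)) * dispersion V x"
  proof (cases "n \<ge> 2")
    case True
    then have "real d * real n / real r = real (size E) * ((real r - 1) / (real n - 1))"
      using count r by (simp add: field_simps)
    then show ?thesis by (simp add: algebra_simps)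
  next
    case False
    \<comment> \<open>An edge of size \<open>r \<ge> 1\<close> makes \<open>V\<close> nonempty, so
      \<open>n = 1\<close>: the fraction divides by zero, but the dispersion on a single vertex is
      0.\<close>
    have "V \<noteq> {}" using E r card edges_subset by fastforce
    then obtain v where "V = {v}"
      using False finite_vertices
      by (metis n_def card_1_singletonE card_gt_0_iff less_2_cases not_le not_less_zero One_nat_def)
    then show ?thesis by (simp add: dispersion_eq)
  qed
  finally show ?thesis by (simp add: n_def)
qed

subsection \<open>Convergence of nonnegative supermartingales\<close>

text \<open>State of the upcrossing counter of the levels \<open>a < b\<close> once \<open>y 0, \<dots>, y (t - 1)\<close> have
  been read: the flag tells whether an upcrossing has started (a value \<open>\<le> a\<close> was seen, but no
  value \<open>\<ge> b\<close> since then), the number is the count of the completed ones.\<close>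

primrec upcrossing_state :: "real \<Rightarrow> real \<Rightarrow> (nat \<Rightarrow> real) \<Rightarrow> nat \<Rightarrow> bool \<times> nat" where
  "upcrossing_state a b y 0 = (False, 0)"
| "upcrossing_state a b y (Suc t) =
    (let (p, k) = upcrossing_state a b y t
     in if p then if b \<le> y t then (False, Suc k) else (True, k) else (y t \<le> a, k))"

abbreviation upcrossings :: "real \<Rightarrow> real \<Rightarrow> (nat \<Rightarrow> real) \<Rightarrow> nat \<Rightarrow> nat" where
  "upcrossings a b y t \<equiv> snd (upcrossing_state a b y t)"

section \<open>Upcrossings of a single sequence\<close>

lemma mono_upcrossings: "mono (upcrossings a b y)"
  by (auto simp: mono_iff_le_Suc split: prod.split)

lemma upcrossings_le: "upcrossings a b y t \<le> t"
  by (induction t) (auto simp: le_SucI split: prod.split)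

text \<open>If no upcrossing ever started, the state would stay \<open>(False, k)\<close> and every
  value from \<open>t\<close> on would exceed \<open>a\<close>. The state at \<open>t\<close> has
  not yet read \<open>y s\<close>, because \<open>t \<le> s\<close>.\<close>

lemma upcrossing_starts:
  assumes "upcrossing_state a b y t = (False, k)" "t \<le> s" "y s \<le> a"
  shows "\<exists>t'. upcrossing_state a b y t' = (True, k)"
proof (rule ccontr)
  assume not: "\<nexists>t'. upcrossing_state a b y t' = (True, k)"
  have step: "upcrossing_state a b y (Suc s) = (False, k) \<and> a < y s"
    if "upcrossing_state a b y s = (False, k)" for s
    using not[unfolded not_ex, rule_format, of "Suc s"] that by (cases "y s \<le> a") auto
  have "upcrossing_state a b y s = (False, k)"
    using assms(2) by (induction s rule: dec_induct) (use assms step in blast)+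
  with step assms(3) show False by fastforce
qed

lemma upcrossing_completes:
  assumes "upcrossing_state a b y t = (True, k)" "t \<le> s" "b \<le> y s"
  shows "\<exists>t'. upcrossing_state a b y t' = (False, Suc k)"
proof (rule ccontr)
  assume not: "\<nexists>t'. upcrossing_state a b y t' = (False, Suc k)"
  have step: "upcrossing_state a b y (Suc s) = (True, k) \<and> y s < b"
    if "upcrossing_state a b y s = (True, k)" for s
    using not[unfolded not_ex, rule_format, of "Suc s"] that by (cases "b \<le> y s") auto
  have "upcrossing_state a b y s = (True, k)"
    using assms(2) by (induction s rule: dec_induct) (use assms step in blast)+
  with step assms(3) show False by fastforce
qed

text \<open>Infinitely many values on either side let \<open>upcrossing_starts\<close> and
  \<open>upcrossing_completes\<close> alternate forever. Asking for the idle state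
  \<open>(False, k)\<close>, and not just the count \<open>k\<close>, lets the induction
  resume.\<close>

lemma frequently_imp_upcrossings:
  assumes "\<exists>\<^sub>F t in sequentially. y t \<le> a" "\<exists>\<^sub>F t in sequentially. b \<le> y t"
  shows "\<exists>t. upcrossing_state a b y t = (False, k)"
proof (induction k)
  case 0
  then show ?case by (metis upcrossing_state.simps(1))
next
  case (Suc k)
  then obtain t where t: "upcrossing_state a b y t = (False, k)" by blast
  obtain s where "t \<le> s" "y s \<le> a" using assms(1) by (auto simp: frequently_sequentially)
  then obtain t' where t': "upcrossing_state a b y t' = (True, k)"
    using upcrossing_starts[OF t] by blast
  obtain s' where "t' \<le> s'" "b \<le> y s'" using assms(2) by (auto simp: frequently_sequentially)
  then show ?case using upcrossing_completes[OF t'] by blast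
qed

text \<open>If liminf and limsup differed, two rationals between them would be crossed infinitely
  often; they are positive because \<open>y\<close> is nonnegative. Rational levels keep the
  exceptional null sets countable in number.\<close>

lemma convergent_if_finite_upcrossings:
  fixes y :: "nat \<Rightarrow> real"
  assumes nonneg: "\<And>t. 0 \<le> y t"
    and fin: "liminf (\<lambda>t. ennreal (y t)) \<noteq> \<infinity>"
    and upc: "\<And>p q :: rat. 0 < p \<Longrightarrow> p < q \<Longrightarrow>
      \<exists>K. \<forall>t. upcrossings (of_rat p) (of_rat q) y t < K"
  shows "convergent y"
proof -
  let ?y = "\<lambda>t. ereal (y t)"
  have "0 \<le> liminf ?y"
    using nonneg by (intro Liminf_bounded) simp
  have "liminf ?y = limsup ?y"
  proof (rule ccontr)
    assume "liminf ?y \<noteq> limsup ?y"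
    then have "liminf ?y < limsup ?y" by (simp add: Liminf_le_Limsup less_le)
    then obtain p :: rat where p: "liminf ?y < ereal (of_rat p)" "ereal (of_rat p) < limsup ?y"
      using ereal_dense3 by blast
    from p(2) obtain q :: rat where q: "ereal (of_rat p) < ereal (of_rat q)" "ereal (of_rat q) < limsup ?y"
      using ereal_dense3 by blast
    have "0 < p" using \<open>0 \<le> liminf ?y\<close> p(1)
      by (metis ereal_less(2) order_le_less_trans zero_less_of_rat_iff)
    moreover have "p < q" using q(1) by (simp add: of_rat_less)
    ultimately obtain K where K: "\<And>t. upcrossings (of_rat p) (of_rat q) y t < K"
      using upc by blast
    have 1: "\<exists>\<^sub>F t in sequentially. y t \<le> of_rat p"
    proof (rule ccontr)
      assume "\<not> ?thesis"
      then have "\<forall>\<^sub>F t in sequentially. ereal (of_rat p) \<le> ?y t"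
        by (auto simp: not_frequently elim: eventually_mono)
      then show False using p(1) Liminf_bounded[of "ereal (of_rat p)" ?y] by (meson leD)
    qed
    have 2: "\<exists>\<^sub>F t in sequentially. of_rat q \<le> y t"
    proof (rule ccontr)
      assume "\<not> ?thesis"
      then have "\<forall>\<^sub>F t in sequentially. ?y t \<le> ereal (of_rat q)"
        by (auto simp: not_frequently elim: eventually_mono)
      then show False using q(2) Limsup_bounded[of ?y "ereal (of_rat q)"] by (meson leD)
    qed
    obtain t where "upcrossing_state (of_rat p) (of_rat q) y t = (False, K)"
      using frequently_imp_upcrossings[OF 1 2] by blast
    then show False using K[of t] by simp
  qed
  then have "?y \<longlonglongrightarrow> liminf ?y"
    by (intro Liminf_eq_Limsup) auto
  moreover have "liminf ?y \<noteq> \<infinity>"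
  proof
    assume "liminf ?y = \<infinity>"
    with \<open>?y \<longlonglongrightarrow> liminf ?y\<close> have "(\<lambda>t. e2ennreal (?y t)) \<longlonglongrightarrow> e2ennreal \<infinity>"
      by (metis tendsto_e2ennrealI)
    then have "(\<lambda>t. ennreal (y t)) \<longlonglongrightarrow> \<infinity>" by simp
    then show False using fin lim_imp_Liminf[OF trivial_limit_sequentially] by blast
  qed
  ultimately obtain l where "?y \<longlonglongrightarrow> ereal l"
    using \<open>0 \<le> liminf ?y\<close> by (cases "liminf ?y") auto
  then show ?thesis by (auto simp: convergent_def)
qed

text \<open>Only indices \<open>s < t\<close> are required, so the state at \<open>Suc t\<close> is
  measurable at time \<open>t\<close>: the gambler's position is predictable.\<close>

lemma measurable_upcrossing_state:
  assumes "\<And>s. s < t \<Longrightarrow> Y s \<in> borel_measurable F"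
  shows "(\<lambda>\<omega>. upcrossing_state a b (\<lambda>s. Y s \<omega>) t) \<in> F \<rightarrow>\<^sub>M count_space UNIV"
  using assms
proof (induction t)
  case 0
  then show ?case by simp
next
  case (Suc t)
  have [measurable]: "Y t \<in> borel_measurable F" using Suc.prems by simp
  have "(\<lambda>\<omega>. (\<lambda>(p, k). if p then if b \<le> Y t \<omega> then (False, Suc k) else (True, k)
      else (Y t \<omega> \<le> a, k)) (upcrossing_state a b (\<lambda>s. Y s \<omega>) t)) \<in> F \<rightarrow>\<^sub>M count_space UNIV"
  \<comment> \<open>The state has a countable type, so it can be frozen at each value
    \<open>s\<close>.\<close>
  proof (rule measurable_compose_countable[OF _ Suc.IH])
    show "(\<lambda>\<omega>. (\<lambda>(p, k). if p then if b \<le> Y t \<omega> then (False, Suc k) else (True, k)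
      else (Y t \<omega> \<le> a, k)) s) \<in> F \<rightarrow>\<^sub>M count_space UNIV" for s
      by (cases s; cases "fst s") simp_all
  qed (use Suc.prems in simp)
  then show ?case by (simp add: Let_def)
qed

section \<open>Doob's upcrossing inequality and supermartingale convergence\<close>

context prob_space
begin

text \<open>The potential is the capital of a gambler who holds one share exactly while an upcrossing is in
  progress, with every purchase booked at price \<open>a\<close> and every sale at price \<open>b\<close>.\<close>

lemma expectation_upcrossings_le:
  assumes ab: "0 < a" "a < b"
    and F: "\<And>t. subalgebra M (F t)" "\<And>s t. s \<le> t \<Longrightarrow> sets (F s) \<subseteq> sets (F t)"
    and Y: "\<And>t. Y t \<in> borel_measurable (F t)" "\<And>t. integrable M (Y t)"
    and nonneg: "\<And>t \<omega>. 0 \<le> Y t \<omega>"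
    and super: "\<And>t. AE \<omega> in M. real_cond_exp M (F t) (Y (Suc t)) \<omega> \<le> Y t \<omega>"
  shows "expectation (\<lambda>\<omega>. real (upcrossings a b (\<lambda>s. Y s \<omega>) t)) \<le> a / (b - a)"
proof -
  define S where "S = (\<lambda>t \<omega>. upcrossing_state a b (\<lambda>s. Y s \<omega>) t)"
  \<comment> \<open>The index \<open>t\<close> fixes the position and the completed upcrossings,
    \<open>t'\<close> the time at which the share is priced, so that price changes and trades can be
    treated apart.\<close>
  define W where "W = (\<lambda>t t' \<omega>. (b - a) * real (snd (S t \<omega>)) +
    (if fst (S t \<omega>) then 1 else 0) * Y t' \<omega> - a * (if fst (S t \<omega>) then 1 else 0))"
  have YF: "Y s \<in> borel_measurable (F t)" if "s \<le> t" for s t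
    using Y(1)[of s] F(2)[OF that] F(1)[of s] F(1)[of t]
    by (metis measurable_from_subalg subalgebra_def)
  have SF: "S (Suc t) \<in> F t \<rightarrow>\<^sub>M count_space UNIV" for t
    unfolding S_def by (rule measurable_upcrossing_state) (simp add: YF)
  have SM[measurable]: "S t \<in> M \<rightarrow>\<^sub>M count_space UNIV" for t
    unfolding S_def using Y(2) by (intro measurable_upcrossing_state) auto
  have [measurable]: "Y t \<in> borel_measurable M" for t using Y(2) by auto
  have int_count: "integrable M (\<lambda>\<omega>. real (snd (S t \<omega>)))" for t
  proof (rule integrable_const_bound[where B = t])
    show "AE \<omega> in M. norm (real (snd (S t \<omega>))) \<le> real t"
      by (simp add: S_def upcrossings_le)
  qed measurable
  have int_flag: "integrable M (\<lambda>\<omega>. if fst (S t \<omega>) then 1 else 0 :: real)" for t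
    using measurable_compose[OF SM, of "\<lambda>s. if fst s then 1 else 0" borel t]
    by (intro integrable_const_bound[where B = 1]) auto
  have int_share: "integrable M (\<lambda>\<omega>. (if fst (S t \<omega>) then 1 else 0) * Y t' \<omega>)" for t t'
    by (rule Bochner_Integration.integrable_bound[OF Y(2)[of t']])
       (use int_flag[of t] in auto)
  have int_W: "integrable M (W t t')" for t t'
    unfolding W_def using int_count int_share int_flag by auto
  have "expectation (W t t) \<le> 0"
  proof (induction t)
    case 0
    then show ?case by (simp add: W_def S_def)
  next
    case (Suc t)
    interpret F: finite_measure_subalgebra M "F t" by unfold_locales (rule F(1))
    define h where "h = (\<lambda>\<omega>. if fst (S (Suc t) \<omega>) then 1 else 0 :: real)"
    have h: "h \<in> borel_measurable (F t)"
      using measurable_compose[OF SF, of "\<lambda>s. if fst s then 1 else 0" borel t] by (simp add: h_def)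
    have int_h: "integrable M (\<lambda>\<omega>. h \<omega> * Y t' \<omega>)" for t'
      using int_share by (simp add: h_def)
    have "integrable M h"
      using int_flag by (simp add: h_def)
    have W: "W (Suc t) t' = (\<lambda>\<omega>. (b - a) * real (snd (S (Suc t) \<omega>)) + h \<omega> * Y t' \<omega> - a * h \<omega>)" for t'
      unfolding W_def h_def ..
    \<comment> \<open>The position \<open>h\<close> is nonnegative and known at time
      \<open>t\<close>, so it can be pulled out of the conditional expectation: holding a share does
      not gain on average.\<close>
    have "expectation (\<lambda>\<omega>. h \<omega> * Y (Suc t) \<omega>) =
        expectation (\<lambda>\<omega>. h \<omega> * real_cond_exp M (F t) (Y (Suc t)) \<omega>)"
      using h int_h by (intro F.real_cond_exp_intg(2)[symmetric]) auto
    also have "\<dots> \<le> expectation (\<lambda>\<omega>. h \<omega> * Y t \<omega>)"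
    proof (intro integral_mono_AE)
      show "AE \<omega> in M. h \<omega> * real_cond_exp M (F t) (Y (Suc t)) \<omega> \<le> h \<omega> * Y t \<omega>"
        using super[of t] by eventually_elim (simp add: h_def)
    qed (use h int_h in \<open>auto intro: F.real_cond_exp_intg(1)\<close>)
    finally have "expectation (W (Suc t) (Suc t)) \<le> expectation (W (Suc t) t)"
      using int_count int_h \<open>integrable M h\<close> by (simp add: W)
    \<comment> \<open>Trading at time \<open>t\<close>: a purchase at \<open>Y t \<le> a\<close> is
      booked at \<open>a\<close>, a sale at \<open>Y t \<ge> b\<close> at \<open>b\<close>, so
      neither raises the potential.\<close>
    also have "\<dots> \<le> expectation (W t t)"
    proof (intro integral_mono int_W)
      show "W (Suc t) t \<omega> \<le> W t t \<omega>" for \<omega>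
        by (auto simp: W_def S_def algebra_simps split: prod.split)
    qed
    finally show ?case using Suc.IH by simp
  qed
  \<comment> \<open>A share still held is worth at least 0, so an open upcrossing costs at most
    \<open>a\<close>.\<close>
  moreover have "(b - a) * expectation (\<lambda>\<omega>. real (snd (S t \<omega>))) - a \<le> expectation (W t t)"
  proof -
    have "expectation (\<lambda>\<omega>. (b - a) * real (snd (S t \<omega>)) - a) \<le> expectation (W t t)"
      using int_W int_count nonneg ab by (intro integral_mono) (auto simp: W_def)
    then show ?thesis using int_count by (simp add: prob_space)
  qed
  ultimately have "(b - a) * expectation (\<lambda>\<omega>. real (snd (S t \<omega>))) \<le> a" by simp
  then show ?thesis using ab by (simp add: S_def field_simps)
qed

text \<open>The counts grow with \<open>t\<close>, so by monotone convergence their supremum has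
  integral at most \<open>c\<close> and is almost surely finite.\<close>

lemma AE_finite_upcrossings:
  assumes Y[measurable]: "\<And>t. Y t \<in> borel_measurable M"
    and le: "\<And>t. expectation (\<lambda>\<omega>. real (upcrossings a b (\<lambda>s. Y s \<omega>) t)) \<le> c"
  shows "AE \<omega> in M. \<exists>K. \<forall>t. upcrossings a b (\<lambda>s. Y s \<omega>) t < K"
proof -
  let ?U = "\<lambda>t \<omega>. upcrossings a b (\<lambda>s. Y s \<omega>) t"
  have [measurable]: "(\<lambda>\<omega>. upcrossing_state a b (\<lambda>s. Y s \<omega>) t) \<in> M \<rightarrow>\<^sub>M count_space UNIV" for t
    by (rule measurable_upcrossing_state) simp
  have int: "integrable M (\<lambda>\<omega>. real (?U t \<omega>))" for t
    by (intro integrable_const_bound[where B = t]) (simp_all add: upcrossings_le)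
  have "(\<integral>\<^sup>+\<omega>. (SUP t. of_nat (?U t \<omega>)) \<partial>M) = (SUP t. \<integral>\<^sup>+\<omega>. of_nat (?U t \<omega>) \<partial>M)"
    by (intro nn_integral_monotone_convergence_SUP)
       (auto intro!: le_funI monoD[OF mono_upcrossings] simp: incseq_def)
  also have "\<dots> \<le> ennreal c"
  proof (rule SUP_least)
    show "(\<integral>\<^sup>+\<omega>. of_nat (?U t \<omega>) \<partial>M) \<le> ennreal c" for t
      using nn_integral_eq_integral[OF int[of t]] le[of t]
      by (simp add: ennreal_of_nat_eq_real_of_nat ennreal_leI)
  qed
  finally have "(\<integral>\<^sup>+\<omega>. (SUP t. of_nat (?U t \<omega>)) \<partial>M) \<noteq> \<infinity>"
    by (auto simp: top_unique)
  then have "AE \<omega> in M. (SUP t. of_nat (?U t \<omega>)) \<noteq> (\<infinity> :: ennreal)"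
    by (intro nn_integral_PInf_AE) auto
  then show ?thesis
  proof eventually_elim
    case (elim \<omega>)
    then obtain K where "(SUP t. of_nat (?U t \<omega>)) < (of_nat K :: ennreal)"
      by (metis ennreal_Ex_less_of_nat less_top infinity_ennreal_def)
    then have "of_nat (?U t \<omega>) < (of_nat K :: ennreal)" for t
      by (meson SUP_lessD UNIV_I)
    then show ?case by auto
  qed
qed

theorem nonneg_supermartingale_AE_convergent:
  assumes F: "\<And>t. subalgebra M (F t)" "\<And>s t. s \<le> t \<Longrightarrow> sets (F s) \<subseteq> sets (F t)"
    and Y: "\<And>t. Y t \<in> borel_measurable (F t)" "\<And>t. integrable M (Y t)"
    and nonneg: "\<And>t \<omega>. 0 \<le> Y t \<omega>"
    and super: "\<And>t. AE \<omega> in M. real_cond_exp M (F t) (Y (Suc t)) \<omega> \<le> Y t \<omega>"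
  shows "AE \<omega> in M. convergent (\<lambda>t. Y t \<omega>)"
proof -
  have [measurable]: "Y t \<in> borel_measurable M" for t using Y(2) by auto
  have "AE \<omega> in M. \<forall>p q :: rat. 0 < p \<and> p < q \<longrightarrow>
      (\<exists>K. \<forall>t. upcrossings (of_rat p) (of_rat q) (\<lambda>s. Y s \<omega>) t < K)"
  proof (intro AE_all_countable[THEN iffD2] allI AE_impI)
    fix p q :: rat assume "0 < p \<and> p < q"
    then have "0 < (of_rat p :: real)" "of_rat p < (of_rat q :: real)"
      by (simp_all add: of_rat_less)
    then show "AE \<omega> in M. \<exists>K. \<forall>t. upcrossings (of_rat p) (of_rat q) (\<lambda>s. Y s \<omega>) t < K"
      using expectation_upcrossings_le[where F = F and Y = Y] assms
      by (intro AE_finite_upcrossings[where c = "of_rat p / (of_rat q - of_rat p)"]) auto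
  qed
  moreover have "AE \<omega> in M. liminf (\<lambda>t. ennreal (Y t \<omega>)) \<noteq> \<infinity>"
  proof (rule nn_integral_PInf_AE)
    \<comment> \<open>Expectations do not increase, so Fatou's lemma bounds the integral of the
      limit inferior by \<open>expectation (Y 0)\<close>.\<close>
    have decr: "expectation (Y t) \<le> expectation (Y 0)" for t
    proof (induction t)
      case (Suc t)
      interpret F: finite_measure_subalgebra M "F t" by unfold_locales (rule F(1))
      have "expectation (Y (Suc t)) = expectation (real_cond_exp M (F t) (Y (Suc t)))"
        using F.real_cond_exp_int(2)[OF Y(2)] by simp
      also have "\<dots> \<le> expectation (Y t)"
        using super Y(2) by (intro integral_mono_AE F.real_cond_exp_int(1)) auto
      finally show ?case using Suc.IH by simp
    qed simp
    have "(\<integral>\<^sup>+\<omega>. liminf (\<lambda>t. ennreal (Y t \<omega>)) \<partial>M) \<le> liminf (\<lambda>t. \<integral>\<^sup>+\<omega>. ennreal (Y t \<omega>) \<partial>M)"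
      by (intro nn_integral_liminf) auto
    also have "\<dots> \<le> liminf (\<lambda>t. ennreal (expectation (Y 0)))"
      using decr nonneg by (intro Liminf_mono always_eventually allI)
        (simp add: nn_integral_eq_integral[OF Y(2)] ennreal_leI)
    also have "\<dots> < \<infinity>" by (simp add: Liminf_const)
    finally show "(\<integral>\<^sup>+\<omega>. liminf (\<lambda>t. ennreal (Y t \<omega>)) \<partial>M) \<noteq> \<infinity>" by simp
  qed simp
  ultimately show ?thesis
  proof eventually_elim
    case (elim \<omega>)
    then show ?case
      by (intro convergent_if_finite_upcrossings nonneg) auto
  qed
qed

end

subsection \<open>The averaging process\<close>

lemma averaging_process_cong:
  assumes "\<And>s. s < t \<Longrightarrow> e s \<omega> = e' s \<omega>'"
  shows "averaging_process e x t \<omega> = averaging_process e' x t \<omega>'"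
  using assms by (induction t) simp_all

text \<open>Cutting off at \<open>t\<close> leaves an extensional function, so edges from a finite
  set give only finitely many histories.\<close>

definition history :: "(nat \<Rightarrow> 'w \<Rightarrow> 'b) \<Rightarrow> nat \<Rightarrow> 'w \<Rightarrow> nat \<Rightarrow> 'b" where
  "history e t \<omega> = (\<lambda>i\<in>{..<t}. e i \<omega>)"

definition process_of_history :: "('a \<Rightarrow> real) \<Rightarrow> nat \<Rightarrow> (nat \<Rightarrow> 'a set) \<Rightarrow> 'a \<Rightarrow> real" where
  "process_of_history x t h = averaging_process (\<lambda>i h. h i) x t h"

lemma averaging_process_history:
  "averaging_process e x t \<omega> = process_of_history x t (history e t \<omega>)"
  unfolding process_of_history_def
  by (rule averaging_process_cong) (simp add: history_def)

lemma sum_mset_eq_sum_count: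
  fixes g :: "'b \<Rightarrow> real"
  shows "(\<Sum>f\<in>#A. g f) = (\<Sum>f\<in>set_mset A. real (count A f) * g f)"
proof -
  \<comment> \<open>Generalised to a superset \<open>S\<close>, since \<open>set_mset A\<close>
    changes during the induction.\<close>
  have "(\<Sum>f\<in>#A. g f) = (\<Sum>f\<in>S. real (count A f) * g f)"
    if "finite S" "set_mset A \<subseteq> S" for S
    using that
  proof (induction A)
    case (add a A)
    have "(\<Sum>f\<in>S. real (count (add_mset a A) f) * g f) =
        (\<Sum>f\<in>S. real (count A f) * g f + (if f = a then g f else 0))"
      by (intro sum.cong) (auto simp: algebra_simps)
    with add show ?case by (simp add: sum.distrib)
  qed simp
  then show ?thesis by simp
qed

section \<open>The filtration of edge histories\<close>

locale edge_sequence =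
  fixes M :: "'w measure" and E :: "'a set multiset" and e :: "nat \<Rightarrow> 'w \<Rightarrow> 'a set"
  assumes uniform: "uniform_edge_sequence M E e" and nonempty: "E \<noteq> {#}"

sublocale edge_sequence \<subseteq> prob_space M
  using uniform by (simp add: uniform_edge_sequence_def)

context edge_sequence
begin

abbreviation histories :: "nat \<Rightarrow> (nat \<Rightarrow> 'a set) set" where
  "histories t \<equiv> {..<t} \<rightarrow>\<^sub>E set_mset E"

text \<open>The natural filtration. The histories carry the discrete algebra, so its events are the
  preimages of arbitrary sets of histories.\<close>

definition history_algebra :: "nat \<Rightarrow> 'w measure" where
  "history_algebra t = vimage_algebra (space M) (history e t) (count_space (histories t))"

lemma indep: "indep_vars (\<lambda>_. count_space (set_mset E)) e UNIV"
  using uniform by (simp add: uniform_edge_sequence_def)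

lemma measurable_edge: "e t \<in> M \<rightarrow>\<^sub>M count_space (set_mset E)"
  using indep by (simp add: indep_vars_def)

lemma measurable_edge_UNIV: "e t \<in> M \<rightarrow>\<^sub>M count_space UNIV"
  by (rule measurable_compose[OF measurable_edge, of "\<lambda>f. f"]) simp

lemma edge_in: "\<omega> \<in> space M \<Longrightarrow> e t \<omega> \<in># E"
  using measurable_space[OF measurable_edge] by simp

lemma prob_edge: "prob {\<omega> \<in> space M. e t \<omega> = f} = count E f / size E"
proof -
  have "prob {\<omega> \<in> space M. e t \<omega> = f} = measure (distr M (count_space UNIV) (e t)) {f}"
    using measurable_edge_UNIV
    by (subst measure_distr) (auto intro: arg_cong[where f = prob])
  also have "\<dots> = count E f / size E"
    using uniform nonempty
    by (simp add: uniform_edge_sequence_def measure_pmf_single)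
  finally show ?thesis .
qed

lemma history_in: "\<omega> \<in> space M \<Longrightarrow> history e t \<omega> \<in> histories t"
  by (auto simp: history_def edge_in)

lemma measurable_history: "history e t \<in> M \<rightarrow>\<^sub>M count_space (histories t)"
proof -
  have "history e t \<in> M \<rightarrow>\<^sub>M PiM {..<t} (\<lambda>_. count_space (set_mset E))"
    unfolding history_def using measurable_edge by (intro measurable_restrict)
  then show ?thesis
    by (subst (asm) count_space_PiM_finite) (auto simp: countable_finite)
qed

text \<open>Only finitely many histories occur, so any function of them is bounded; this covers
  arbitrary functions of the process.\<close>

lemma integrable_history: "integrable M (\<lambda>\<omega>. g (history e t \<omega>) :: real)"
proof (rule integrable_const_bound)
  have "finite (histories t)" by (intro finite_PiE) auto
  then show "AE \<omega> in M. norm (g (history e t \<omega>)) \<le> (\<Sum>h\<in>histories t. \<bar>g h\<bar>)"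
    using history_in by (intro AE_I2) (auto intro!: member_le_sum)
  show "(\<lambda>\<omega>. g (history e t \<omega>)) \<in> borel_measurable M"
    using measurable_history by (rule measurable_compose) simp
qed

lemma integrable_averaging_process: "integrable M (\<lambda>\<omega>. g (averaging_process e x t \<omega>) :: real)"
  unfolding averaging_process_history by (rule integrable_history)

lemma subalgebra_history: "subalgebra M (history_algebra t)"
  using measurable_sets[OF measurable_history[of t]] history_in
  by (auto simp: subalgebra_def history_algebra_def sets_vimage_algebra2)

lemma sets_history_algebra:
  "sets (history_algebra t) = {history e t -` B \<inter> space M | B. B \<subseteq> histories t}"
  using history_in by (subst history_algebra_def, subst sets_vimage_algebra2) auto

lemma sets_history_algebra_mono:
  assumes "s \<le> t"
  shows "sets (history_algebra s) \<subseteq> sets (history_algebra t)"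
proof
  fix A assume "A \<in> sets (history_algebra s)"
  then obtain B where A: "A = history e s -` B \<inter> space M"
    by (auto simp: sets_history_algebra)
  have *: "history e s \<omega> = restrict (history e t \<omega>) {..<s}" for \<omega>
    using assms by (auto simp: history_def fun_eq_iff restrict_def)
  then have "A = history e t -` {h \<in> histories t. restrict h {..<s} \<in> B} \<inter> space M"
    using history_in unfolding A * by blast
  then show "A \<in> sets (history_algebra t)"
    unfolding sets_history_algebra by blast
qed

lemma measurable_history_algebra:
  "(\<lambda>\<omega>. g (history e t \<omega>)) \<in> borel_measurable (history_algebra t)"
proof (rule measurable_compose[where f = "history e t" and g = g])
  show "history e t \<in> history_algebra t \<rightarrow>\<^sub>M count_space (histories t)"
    unfolding history_algebra_def using history_in by (intro measurable_vimage_algebra1) auto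
qed simp

text \<open>The next edge is independent of the history and uniform on \<open>E\<close>, so
  conditionally on the history it is averaged over \<open>E\<close> with multiplicity.\<close>

lemma expectation_history_edge:
  fixes g :: "(nat \<Rightarrow> 'a set) \<Rightarrow> 'a set \<Rightarrow> real"
  shows "expectation (\<lambda>\<omega>. g (history e t \<omega>) (e t \<omega>)) =
    expectation (\<lambda>\<omega>. (\<Sum>f\<in>#E. g (history e t \<omega>) f)) / size E"
proof -
  let ?P = "\<lambda>A. PiM A (\<lambda>_. count_space (set_mset E))"
  have P: "?P A = count_space (A \<rightarrow>\<^sub>E set_mset E)" if "finite A" for A :: "nat set"
    using that by (intro count_space_PiM_finite) (auto simp: countable_finite)
  have ind: "indep_var borel (\<lambda>\<omega>. g (history e t \<omega>) f) borel (\<lambda>\<omega>. indicator {f} (e t \<omega>) :: real)" for f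
  proof -
    have "indep_var (?P {..<t}) (\<lambda>\<omega>. restrict (\<lambda>i. e i \<omega>) {..<t}) (?P {t}) (\<lambda>\<omega>. restrict (\<lambda>i. e i \<omega>) {t})"
      by (rule indep_var_restrict[OF indep]) auto
    then have "indep_var borel ((\<lambda>h. g h f) \<circ> (\<lambda>\<omega>. restrict (\<lambda>i. e i \<omega>) {..<t}))
        borel ((\<lambda>h. indicator {f} (h t) :: real) \<circ> (\<lambda>\<omega>. restrict (\<lambda>i. e i \<omega>) {t}))"
      by (rule indep_var_compose) (simp_all add: P)
    then show ?thesis by (simp add: o_def history_def)
  qed
  have int_g: "integrable M (\<lambda>\<omega>. g (history e t \<omega>) f)" for f
    by (rule integrable_history)
  have int: "integrable M (\<lambda>\<omega>. indicator {f} (e t \<omega>) :: real)" for f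
    using measurable_compose[OF measurable_edge, of "indicator {f}" borel t]
    by (intro integrable_const_bound[where B = 1]) auto
  have prob: "expectation (\<lambda>\<omega>. indicator {f} (e t \<omega>)) = count E f / size E" for f
  proof -
    have "{\<omega> \<in> space M. e t \<omega> = f} \<in> events"
      using measurable_sets[OF measurable_edge_UNIV, of "{f}" t]
      by (simp add: vimage_def Int_def conj_commute)
    then have "expectation (indicator {\<omega> \<in> space M. e t \<omega> = f}) = count E f / size E"
      by (simp add: prob_edge)
    then show ?thesis
      by (auto simp: indicator_def cong: Bochner_Integration.integral_cong)
  qed
  \<comment> \<open>Splitting by the value \<open>f\<close> of the next edge makes every summand a
    product of independent factors.\<close>
  have "expectation (\<lambda>\<omega>. g (history e t \<omega>) (e t \<omega>)) =
      expectation (\<lambda>\<omega>. \<Sum>f\<in>set_mset E. g (history e t \<omega>) f * indicator {f} (e t \<omega>))"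
    using edge_in by (intro Bochner_Integration.integral_cong refl)
      (simp add: indicator_def if_distrib cong: if_cong)
  also have "\<dots> = (\<Sum>f\<in>set_mset E. expectation (\<lambda>\<omega>. g (history e t \<omega>) f) * (count E f / size E))"
    using indep_var_lebesgue_integral[OF ind int_g int] indep_var_integrable[OF ind int_g int]
    by (subst Bochner_Integration.integral_sum) (simp_all add: prob)
  also have "\<dots> = (\<Sum>f\<in>set_mset E. count E f * expectation (\<lambda>\<omega>. g (history e t \<omega>) f)) / size E"
    by (simp add: sum_divide_distrib mult.commute)
  also have "(\<Sum>f\<in>set_mset E. count E f * expectation (\<lambda>\<omega>. g (history e t \<omega>) f)) =
      expectation (\<lambda>\<omega>. \<Sum>f\<in>set_mset E. count E f * g (history e t \<omega>) f)"
    using int_g by (subst Bochner_Integration.integral_sum) auto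
  also have "\<dots> = expectation (\<lambda>\<omega>. \<Sum>f\<in>#E. g (history e t \<omega>) f)"
    by (simp add: sum_mset_eq_sum_count)
  finally show ?thesis .
qed

section \<open>Expected dispersion and its normalised martingale\<close>

text \<open>Averaging over edges inside \<open>V\<close> preserves the mean, so centring at the
  initial mean is centring at the current one. Membership in \<open>space M\<close> guarantees that
  all edges lie in \<open>E\<close>.\<close>

lemma dispersion_averaging_process:
  assumes H: "hypergraph V E" and \<omega>: "\<omega> \<in> space M"
  shows "(L2_set (\<lambda>v. averaging_process e x t \<omega> v - mean_vector V x v) V)\<^sup>2 =
    dispersion V (averaging_process e x t \<omega>)"
proof -
  interpret hypergraph V E by fact
  have "mean_vector V (averaging_process e x t \<omega>) = mean_vector V x"
    using edge_in[OF \<omega>] edges_subset finite_vertices by (intro mean_vector_averaging_process) auto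
  then show ?thesis by (simp add: dispersion_def)
qed

text \<open>The martingale property of \<open>dispersion / c ^ t\<close>, tested on the events of the history.\<close>

lemma set_integral_dispersion_Suc:
  fixes c :: real
  assumes mean: "\<And>y. (\<Sum>f\<in>#E. dispersion V (average_edge f y)) = size E * c * dispersion V y"
    and A: "A \<in> sets (history_algebra t)"
  shows "(LINT \<omega>:A|M. dispersion V (averaging_process e x (Suc t) \<omega>)) =
    c * (LINT \<omega>:A|M. dispersion V (averaging_process e x t \<omega>))"
proof -
  obtain B where B: "A = history e t -` B \<inter> space M"
    using A by (auto simp: sets_history_algebra)
  \<comment> \<open>The event \<open>A\<close> is decided by the history, so its indicator becomes a
    factor depending on the history alone.\<close>
  define g where "g = (\<lambda>h f. indicator B h * dispersion V (average_edge f (process_of_history x t h)))"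
  have "(LINT \<omega>:A|M. dispersion V (averaging_process e x (Suc t) \<omega>)) =
      expectation (\<lambda>\<omega>. g (history e t \<omega>) (e t \<omega>))"
    unfolding set_lebesgue_integral_def g_def B
    by (intro Bochner_Integration.integral_cong refl)
       (simp add: averaging_process_history[of e x t] indicator_def)
  also have "\<dots> = expectation (\<lambda>\<omega>. (\<Sum>f\<in>#E. g (history e t \<omega>) f)) / size E"
    by (rule expectation_history_edge)
  also have "\<dots> = expectation (\<lambda>\<omega>. size E * (c * (indicator A \<omega> *
      dispersion V (averaging_process e x t \<omega>)))) / size E"
  proof (rule arg_cong[where f = "\<lambda>z. z / size E"], intro Bochner_Integration.integral_cong refl)
    fix \<omega> assume "\<omega> \<in> space M"
    then show "(\<Sum>f\<in>#E. g (history e t \<omega>) f) = size E * (c * (indicator A \<omega> *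
        dispersion V (averaging_process e x t \<omega>)))"
      unfolding g_def B
      by (simp add: mean averaging_process_history[of e x t] indicator_def
          flip: sum_mset_distrib_left)
  qed
  also have "\<dots> = c * (LINT \<omega>:A|M. dispersion V (averaging_process e x t \<omega>))"
    using nonempty by (simp add: set_lebesgue_integral_def)
  finally show ?thesis .
qed

text \<open>The whole space is an event of every history algebra, so the one-step identity on it
  gives the recursion.\<close>

lemma expectation_dispersion:
  fixes c :: real
  assumes mean: "\<And>y. (\<Sum>f\<in>#E. dispersion V (average_edge f y)) = size E * c * dispersion V y"
  shows "expectation (\<lambda>\<omega>. dispersion V (averaging_process e x t \<omega>)) = c ^ t * dispersion V x"
proof (induction t)
  case 0
  then show ?case by (simp add: prob_space)
next
  case (Suc t)
  have "space M \<in> sets (history_algebra t)"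
    by (metis sets.top subalgebra_def subalgebra_history)
  then have "(LINT \<omega>:space M|M. dispersion V (averaging_process e x (Suc t) \<omega>)) =
      c * (LINT \<omega>:space M|M. dispersion V (averaging_process e x t \<omega>))"
    by (rule set_integral_dispersion_Suc[OF mean])
  then show ?case using Suc.IH
    by (simp add: set_integral_space integrable_averaging_process del: averaging_process.simps)
qed

lemma AE_convergent_dispersion:
  fixes c :: real
  assumes mean: "\<And>y. (\<Sum>f\<in>#E. dispersion V (average_edge f y)) = size E * c * dispersion V y"
    and c: "0 \<le> c"
  shows "AE \<omega> in M. convergent (\<lambda>t. dispersion V (averaging_process e x t \<omega>) / c ^ t)"
proof (cases "c = 0")
  case True
  \<comment> \<open>Every quotient from index 1 on divides by 0 and hence is 0. In the application
    all edges then equal \<open>V\<close>, and one step already makes the vector constant.\<close>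
  have "convergent (\<lambda>t. dispersion V (averaging_process e x (Suc t) \<omega>) / c ^ Suc t)" for \<omega>
    by (simp add: True convergent_const)
  then have "convergent (\<lambda>t. dispersion V (averaging_process e x t \<omega>) / c ^ t)" for \<omega>
    by (subst (asm) convergent_Suc_iff)
  then show ?thesis by simp
next
  case False
  let ?D = "\<lambda>t \<omega>. dispersion V (averaging_process e x t \<omega>)"
  let ?Y = "\<lambda>t \<omega>. ?D t \<omega> / c ^ t"
  have int: "integrable M (?Y t)" for t
    by (rule integrable_averaging_process)
  have adapted: "?Y t \<in> borel_measurable (history_algebra t)" for t
    unfolding averaging_process_history by (rule measurable_history_algebra)
  show ?thesis
  proof (rule nonneg_supermartingale_AE_convergent)
    fix t
    interpret F: finite_measure_subalgebra M "history_algebra t"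
      by unfold_locales (rule subalgebra_history)
    \<comment> \<open>Conditional expectation is characterised by its integrals over events of the
      history; these agree by the one-step identity, rescaled by powers of
      \<open>c \<noteq> 0\<close>.\<close>
    have "AE \<omega> in M. real_cond_exp M (history_algebra t) (?Y (Suc t)) \<omega> = ?Y t \<omega>"
    proof (rule F.real_cond_exp_charact[OF _ int int adapted])
      fix A assume "A \<in> sets (history_algebra t)"
      then have "(LINT \<omega>:A|M. ?D (Suc t) \<omega>) = c * (LINT \<omega>:A|M. ?D t \<omega>)"
        by (rule set_integral_dispersion_Suc[OF mean])
      then show "(LINT \<omega>:A|M. ?Y (Suc t) \<omega>) = (LINT \<omega>:A|M. ?Y t \<omega>)"
        using False by (simp del: averaging_process.simps)
    qed
    then show "AE \<omega> in M. real_cond_exp M (history_algebra t) (?Y (Suc t)) \<omega> \<le> ?Y t \<omega>"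
      by eventually_elim simp
    show "?Y t \<in> borel_measurable (history_algebra t)"
      by (rule adapted)
    show "integrable M (?Y t)"
      by (rule int)
    show "0 \<le> ?Y t \<omega>" for \<omega>
      using c by (simp add: dispersion_nonneg)
  qed (rule subalgebra_history sets_history_algebra_mono; assumption?)+
qed

end

theorem theorem1p3:
  fixes V :: "'a set" and E :: "'a set multiset" and n r :: nat
    and M :: "'w measure" and e :: "nat \<Rightarrow> 'w \<Rightarrow> 'a set"
    and x :: "'a \<Rightarrow> real"
  assumes "hypergraph V E"
    and "E \<noteq> {#}"
    and "card V = n"
    and "r \<ge> 1"
    and "uniform_hypergraph r E"
    and "codegree_regular V E"
    and "uniform_edge_sequence M E e"
  shows "(\<forall>t\<ge>1. prob_space.expectation M
              (\<lambda>\<omega>. (L2_set (\<lambda>v. averaging_process e x t \<omega> v - mean_vector V x v) V)\<^sup>2)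
            = (1 - (real r - 1) / (real n - 1)) ^ t
                * (L2_set (\<lambda>v. x v - mean_vector V x v) V)\<^sup>2)
       \<and> (AE \<omega> in M. convergent
            (\<lambda>t. (L2_set (\<lambda>v. averaging_process e x t \<omega> v - mean_vector V x v) V)\<^sup>2
                  / (1 - (real r - 1) / (real n - 1)) ^ t))"
proof (intro conjI allI impI)
  interpret edge_sequence M E e by unfold_locales (use assms in auto)
  let ?c = "1 - (real r - 1) / (real n - 1)"
  note mean = sum_dispersion_average_edge[OF assms(1,2,4,5,6), unfolded assms(3)]
  note D = dispersion_averaging_process[OF assms(1)]
  have "expectation (\<lambda>\<omega>. (L2_set (\<lambda>v. averaging_process e x t \<omega> v - mean_vector V x v) V)\<^sup>2) =
      expectation (\<lambda>\<omega>. dispersion V (averaging_process e x t \<omega>))" for t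
    by (intro Bochner_Integration.integral_cong refl D)
  then show "expectation (\<lambda>\<omega>. (L2_set (\<lambda>v. averaging_process e x t \<omega> v - mean_vector V x v) V)\<^sup>2) =
      ?c ^ t * (L2_set (\<lambda>v. x v - mean_vector V x v) V)\<^sup>2" for t
    using expectation_dispersion[OF mean, of x t] by (simp add: dispersion_def)
  have "r \<le> n"
  proof -
    obtain f where f: "f \<in># E" using assms(2) by auto
    then have "f \<subseteq> V" "finite V" "card f = r"
      using assms(1,5) by (auto simp: hypergraph_def uniform_hypergraph_def)
    then show ?thesis using card_mono assms(3) by blast
  qed
  \<comment> \<open>If \<open>n = 1\<close>, division by zero makes \<open>?c = 1\<close>; otherwise
    \<open>r - 1 \<le> n - 1\<close>.\<close>
  then have "0 \<le> ?c"
    using assms(4) by (cases "n = 1") (auto simp: field_simps)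
  \<comment> \<open>\<open>D\<close> speaks of outcomes in \<open>space M\<close>, which
    \<open>AE_space\<close> supplies.\<close>
  from AE_convergent_dispersion[OF mean this, of x] AE_space
  show "AE \<omega> in M. convergent
      (\<lambda>t. (L2_set (\<lambda>v. averaging_process e x t \<omega> v - mean_vector V x v) V)\<^sup>2 / ?c ^ t)"
    by eventually_elim (simp add: D)
qed

end
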